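(* Let $M$ be a smooth manifold of positive dimension. There are no homotheties of the mean curvature flow $F:M\times[0,T)\to(\mathbb{R}^n,\langle\cdot,\cdot\rangle)$, $T>0$, with nondegenerate induced metric such that $F(M,0)\subset\mathcal{H}^{n-1}(0)$.
   Context: $\langle\cdot,\cdot\rangle$ is a nondegenerate symmetric bilinear form on $\mathbb{R}^n$ (not necessarily definite); $\|X\|^2=\langle X,X\rangle$; $\mathcal{H}^{n-1}(0)=\{x\in\mathbb{R}^n:\|x\|^2=0\}$ is the light cone. $M$ is (nonempty) connected, orientable and complete. A solution of the mean curvature flow is a smooth family of immersions $F:M\times[0,T)\to\mathbb{R}^n$ with $F(\cdot,t)^*\langle\cdot,\cdot\rangle$ nondegenerate for all $t\in[0,T)$ and $\frac{dF}{dt}=\vec H$, where $\vec H$ is the mean curvature vector (trace of the second fundamental tensor) of $F(\cdot,t)$. It is a homothety if there is a differentiable $c:[0,T)\to(0,\infty)$ with $c(0)=1$ and $\vec H=-\frac{\dot c}{c}F^\perp$, where $F^\perp$ is the normal part of the position vector. *)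

theory Defs
  imports "HOL-Analysis.Analysis"
begin

section \<open>Smooth maps between Euclidean spaces\<close>

text \<open>On an open set \<open>S\<close>, \<open>Ck_on k S f\<close> says that \<open>f\<close> is \<open>k\<close> times continuously differentiable.\<close>

primrec Ck_on :: "nat \<Rightarrow> 'a::euclidean_space set \<Rightarrow> ('a \<Rightarrow> 'b::real_normed_vector) \<Rightarrow> bool" where
  "Ck_on 0 S f \<longleftrightarrow> continuous_on S f"
| "Ck_on (Suc k) S f \<longleftrightarrow>
     (\<forall>x\<in>S. f differentiable (at x)) \<and> (\<forall>v. Ck_on k S (\<lambda>x. frechet_derivative f (at x) v))"

text \<open>Smoothness on an arbitrary set means local smooth extendability. This is needed for the
  half-open time interval \<open>[0,T)\<close>; on open sets it is the usual notion.\<close>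

definition smooth_on :: "'a::euclidean_space set \<Rightarrow> ('a \<Rightarrow> 'b::real_normed_vector) \<Rightarrow> bool" where
  "smooth_on S f \<longleftrightarrow>
     (\<forall>x\<in>S. \<exists>W g. open W \<and> x \<in> W \<and> (\<forall>k. Ck_on k W g) \<and> (\<forall>y\<in>S \<inter> W. g y = f y))"


section \<open>Smooth manifolds\<close>

text \<open>A chart is a pair of its domain and its coordinate map. The dimension of the manifold is
  \<open>CARD('m)\<close>, which is always positive.\<close>

type_synonym ('a, 'm) chart = "'a set \<times> ('a \<Rightarrow> real ^ 'm)"

definition is_chart :: "'a topology \<Rightarrow> ('a, 'm::finite) chart \<Rightarrow> bool" where
  "is_chart X c \<longleftrightarrow> openin X (fst c) \<and> open (snd c ` fst c) \<and>
     homeomorphic_map (subtopology X (fst c)) (top_of_set (snd c ` fst c)) (snd c)"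

definition local_rep :: "('a, 'm::finite) chart \<Rightarrow> ('a \<Rightarrow> 'b) \<Rightarrow> real ^ 'm \<Rightarrow> 'b" where
  "local_rep c f x = f (inv_into (fst c) (snd c) x)"

text \<open>The transition map from \<open>c\<close> to \<open>d\<close> is \<open>local_rep c (snd d)\<close> on the following set.\<close>

definition overlap :: "('a, 'm::finite) chart \<Rightarrow> ('a, 'm) chart \<Rightarrow> (real ^ 'm) set" where
  "overlap c d = snd c ` (fst c \<inter> fst d)"

definition smooth_atlas :: "'a topology \<Rightarrow> ('a, 'm::finite) chart set \<Rightarrow> bool" where
  "smooth_atlas X A \<longleftrightarrow>
     (\<forall>c\<in>A. is_chart X c) \<and> (\<Union>c\<in>A. fst c) = topspace X \<and>
     (\<forall>c\<in>A. \<forall>d\<in>A. smooth_on (overlap c d) (local_rep c (snd d)))"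

definition smooth_manifold :: "'a topology \<Rightarrow> ('a, 'm::finite) chart set \<Rightarrow> bool" where
  "smooth_manifold X A \<longleftrightarrow> Hausdorff_space X \<and> second_countable X \<and> smooth_atlas X A"

text \<open>The oriented atlas need not be contained in \<open>A\<close>, but must define the same smooth structure.\<close>

definition orientable :: "'a topology \<Rightarrow> ('a, 'm::finite) chart set \<Rightarrow> bool" where
  "orientable X A \<longleftrightarrow>
     (\<exists>O'. smooth_atlas X O' \<and> smooth_atlas X (A \<union> O') \<and>
        (\<forall>c\<in>O'. \<forall>d\<in>O'. \<forall>x\<in>overlap c d.
           det (matrix (frechet_derivative (local_rep c (snd d)) (at x))) > 0))"


section \<open>Bilinear forms\<close>

definition nondegenerate :: "('v::real_vector \<Rightarrow> 'v \<Rightarrow> real) \<Rightarrow> bool" where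
  "nondegenerate b \<longleftrightarrow> (\<forall>v. (\<forall>w. b v w = 0) \<longrightarrow> v = 0)"

definition light_cone :: "('v::real_vector \<Rightarrow> 'v \<Rightarrow> real) \<Rightarrow> 'v set" where
  "light_cone B = {x. B x x = 0}"

text \<open>If \<open>B\<close> is nondegenerate on the subspace \<open>S\<close>, the whole space is the direct sum of \<open>S\<close> and its
  \<open>B\<close>-orthogonal complement, and the following is the projection to the latter.\<close>

definition normal_part ::
    "('v::real_vector \<Rightarrow> 'v \<Rightarrow> real) \<Rightarrow> 'v set \<Rightarrow> 'v \<Rightarrow> 'v" where
  "normal_part B S v = (THE w. (\<forall>u\<in>S. B w u = 0) \<and> v - w \<in> S)"


section \<open>Geometry of a parametrized immersion\<close>

context
  fixes B :: "real ^ 'n \<Rightarrow> real ^ 'n \<Rightarrow> real" and f :: "real ^ 'm \<Rightarrow> real ^ 'n"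
begin

definition pullback_form :: "real ^ 'm \<Rightarrow> real ^ 'm \<Rightarrow> real ^ 'm \<Rightarrow> real" where
  "pullback_form x v w = B (frechet_derivative f (at x) v) (frechet_derivative f (at x) w)"

definition gram :: "real ^ 'm \<Rightarrow> real ^ 'm ^ 'm" where
  "gram x = (\<chi> i j. pullback_form x (axis i 1) (axis j 1))"

definition second_fundamental :: "real ^ 'm \<Rightarrow> real ^ 'm \<Rightarrow> real ^ 'm \<Rightarrow> real ^ 'n" where
  "second_fundamental x v w =
     normal_part B (range (frechet_derivative f (at x)))
       (frechet_derivative (\<lambda>y. frechet_derivative f (at y) w) (at x) v)"

text \<open>The trace is taken with respect to the induced metric.\<close>

definition mean_curvature :: "real ^ 'm \<Rightarrow> real ^ 'n" where
  "mean_curvature x =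
     (\<Sum>i\<in>UNIV. \<Sum>j\<in>UNIV.
        matrix_inv (gram x) $ i $ j *\<^sub>R second_fundamental x (axis i 1) (axis j 1))"

definition christoffel :: "real ^ 'm \<Rightarrow> 'm \<Rightarrow> 'm \<Rightarrow> 'm \<Rightarrow> real" where
  "christoffel x k i j =
     (let dg = (\<lambda>i j l. frechet_derivative (\<lambda>y. gram y $ j $ l) (at x) (axis i 1))
      in (1 / 2) * (\<Sum>l\<in>UNIV. matrix_inv (gram x) $ k $ l * (dg i j l + dg j i l - dg l i j)))"

end


section \<open>Immersed manifolds\<close>

text \<open>The notions below that use \<open>chart_at\<close> (tangent space, immersivity, nondegeneracy, mean curvature
  vector) do not depend on which chart around \<open>p\<close> is chosen.\<close>

definition chart_at :: "('a, 'm::finite) chart set \<Rightarrow> 'a \<Rightarrow> ('a, 'm) chart" where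
  "chart_at A p = (SOME c. c \<in> A \<and> p \<in> fst c)"

definition rep_at :: "('a, 'm::finite) chart set \<Rightarrow> ('a \<Rightarrow> 'b) \<Rightarrow> 'a \<Rightarrow> real ^ 'm \<Rightarrow> 'b" where
  "rep_at A f p = local_rep (chart_at A p) f"

definition coord_at :: "('a, 'm::finite) chart set \<Rightarrow> 'a \<Rightarrow> real ^ 'm" where
  "coord_at A p = snd (chart_at A p) p"

definition differential ::
    "('a, 'm::finite) chart set \<Rightarrow> ('a \<Rightarrow> real ^ 'n) \<Rightarrow> 'a \<Rightarrow> real ^ 'm \<Rightarrow> real ^ 'n" where
  "differential A f p = frechet_derivative (rep_at A f p) (at (coord_at A p))"

definition induced_metric ::
    "(real ^ 'n \<Rightarrow> real ^ 'n \<Rightarrow> real) \<Rightarrow> ('a, 'm::finite) chart set \<Rightarrow> ('a \<Rightarrow> real ^ 'n) \<Rightarrow>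
     'a \<Rightarrow> real ^ 'm \<Rightarrow> real ^ 'm \<Rightarrow> real" where
  "induced_metric B A f p = pullback_form B (rep_at A f p) (coord_at A p)"

definition normal_component ::
    "(real ^ 'n \<Rightarrow> real ^ 'n \<Rightarrow> real) \<Rightarrow> ('a, 'm::finite) chart set \<Rightarrow> ('a \<Rightarrow> real ^ 'n) \<Rightarrow>
     'a \<Rightarrow> real ^ 'n \<Rightarrow> real ^ 'n" where
  "normal_component B A f p = normal_part B (range (differential A f p))"

definition mean_curvature_vector ::
    "(real ^ 'n \<Rightarrow> real ^ 'n \<Rightarrow> real) \<Rightarrow> ('a, 'm::finite) chart set \<Rightarrow> ('a \<Rightarrow> real ^ 'n) \<Rightarrow>
     'a \<Rightarrow> real ^ 'n" where
  "mean_curvature_vector B A f p = mean_curvature B (rep_at A f p) (coord_at A p)"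

text \<open>Geodesics of the induced (possibly indefinite) metric on an open interval \<open>I\<close>: the geodesic
  equation of the Levi-Civita connection holds in every chart of the atlas.\<close>

definition is_geodesic ::
    "(real ^ 'n \<Rightarrow> real ^ 'n \<Rightarrow> real) \<Rightarrow> 'a topology \<Rightarrow> ('a, 'm::finite) chart set \<Rightarrow>
     ('a \<Rightarrow> real ^ 'n) \<Rightarrow> real set \<Rightarrow> (real \<Rightarrow> 'a) \<Rightarrow> bool" where
  "is_geodesic B X A f I \<gamma> \<longleftrightarrow>
     continuous_map (top_of_set I) X \<gamma> \<and>
     (\<forall>c\<in>A. \<exists>x' x''. \<forall>s\<in>I. \<gamma> s \<in> fst c \<longrightarrow>
        ((\<lambda>r. snd c (\<gamma> r)) has_vector_derivative x' s) (at s) \<and>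
        (x' has_vector_derivative x'' s) (at s) \<and>
        (\<forall>k. x'' s $ k +
           (\<Sum>i\<in>UNIV. \<Sum>j\<in>UNIV.
              christoffel B (local_rep c f) (snd c (\<gamma> s)) k i j * x' s $ i * x' s $ j) = 0))"

text \<open>Geodesic completeness, the notion of completeness available for indefinite metrics: every
  geodesic extends to the whole real line.\<close>

definition complete_metric ::
    "(real ^ 'n \<Rightarrow> real ^ 'n \<Rightarrow> real) \<Rightarrow> 'a topology \<Rightarrow> ('a, 'm::finite) chart set \<Rightarrow>
     ('a \<Rightarrow> real ^ 'n) \<Rightarrow> bool" where
  "complete_metric B X A f \<longleftrightarrow>
     (\<forall>I \<gamma>. open I \<and> is_interval I \<and> I \<noteq> {} \<and> is_geodesic B X A f I \<gamma> \<longrightarrow>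
        (\<exists>\<gamma>'. is_geodesic B X A f UNIV \<gamma>' \<and> (\<forall>s\<in>I. \<gamma>' s = \<gamma> s)))"


section \<open>Mean curvature flow\<close>

text \<open>The half-open interval \<open>[0,T)\<close>; \<open>T = \<infinity>\<close> is allowed.\<close>

definition time_interval :: "ereal \<Rightarrow> real set" where
  "time_interval T = {t. 0 \<le> t \<and> ereal t < T}"

text \<open>\<open>F p t\<close> is the position at time \<open>t\<close>; only its values for \<open>p\<close> in \<open>topspace X\<close> and \<open>t\<close> in
  \<open>[0,T)\<close> matter. The time derivative is one-sided at \<open>0\<close>.\<close>

definition mcf_solution ::
    "(real ^ 'n \<Rightarrow> real ^ 'n \<Rightarrow> real) \<Rightarrow> 'a topology \<Rightarrow> ('a, 'm::finite) chart set \<Rightarrow> ereal \<Rightarrow>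
     ('a \<Rightarrow> real \<Rightarrow> real ^ 'n) \<Rightarrow> bool" where
  "mcf_solution B X A T F \<longleftrightarrow>
     (\<forall>c\<in>A. smooth_on ((snd c ` fst c) \<times> time_interval T) (\<lambda>(x, t). local_rep c F x t)) \<and>
     (\<forall>p\<in>topspace X. \<forall>t\<in>time_interval T.
        inj (differential A (\<lambda>q. F q t) p) \<and>
        nondegenerate (induced_metric B A (\<lambda>q. F q t) p) \<and>
        (F p has_vector_derivative mean_curvature_vector B A (\<lambda>q. F q t) p)
          (at t within time_interval T))"

definition mcf_homothety ::
    "(real ^ 'n \<Rightarrow> real ^ 'n \<Rightarrow> real) \<Rightarrow> 'a topology \<Rightarrow> ('a, 'm::finite) chart set \<Rightarrow> ereal \<Rightarrow>
     ('a \<Rightarrow> real \<Rightarrow> real ^ 'n) \<Rightarrow> bool" where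
  "mcf_homothety B X A T F \<longleftrightarrow>
     mcf_solution B X A T F \<and>
     (\<exists>c c'. c 0 = 1 \<and>
        (\<forall>t\<in>time_interval T. c t > 0 \<and>
           (c has_real_derivative c' t) (at t within time_interval T) \<and>
           (\<forall>p\<in>topspace X.
              mean_curvature_vector B A (\<lambda>q. F q t) p =
                - (c' t / c t) *\<^sub>R normal_component B A (\<lambda>q. F q t) p (F p t))))"

end

theory Submission
  imports Defs
begin

text \<open>The contradiction already arises at time \<open>0\<close>, by looking at the position vector. If \<open>B (f y) (f y) = 0\<close> along an immersion \<open>f\<close>, one
  derivative gives \<open>B (f y) (Df v) = 0\<close>, so the position vector is normal. A second derivative gives
  \<open>B (f y) (D\<^sup>2f v w) = - g v w\<close> for the induced metric \<open>g\<close>, and because the position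
  vector is normal, \<open>D\<^sup>2f v w\<close> can be replaced here by its normal part, the second fundamental
  tensor. Tracing with respect to \<open>g\<close> yields
  \<open>B (f y) (H y) = - m\<close>, where \<open>m\<close> is the dimension (lemma
  \<open>null_position_mean_curvature\<close>). For a homothety, however, \<open>H\<close> at time \<open>0\<close> is a multiple of the
  normal part of the position vector, which is the null position vector itself, so that
  \<open>B (f y) (H y) = 0\<close>. This contradicts \<open>m > 0\<close>.

  The argument is local and is carried out in one chart around one point; smoothness in space-time
  supplies the two spatial derivatives (lemma \<open>smooth_on_time_slice\<close>).\<close>

section \<open>Normal parts and Gram matrices\<close>

lemma bilinear_eq_on_range_from_axes:
  fixes B :: "'v::real_vector \<Rightarrow> 'w::real_vector \<Rightarrow> real" and D :: "real ^ 'm \<Rightarrow> 'w"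
  assumes B: "bilinear B" and D: "linear D"
    and axes: "\<And>j. B a (D (axis j 1)) = B b (D (axis j 1))"
  shows "B a (D w) = B b (D w)"
proof -
  have lin: "linear (\<lambda>w. B z (D w))" for z
    using linear_compose[OF D, of "B z"] B by (auto simp: bilinear_def o_def)
  show ?thesis
  proof (rule linear_eq_on_span[OF lin lin, of Basis])
    show "B a (D x) = B b (D x)" if "x \<in> Basis" for x
      using that axes by (auto simp: Basis_vec_def)
  qed simp
qed

text \<open>The endomorphism below represents the pulled-back form in coordinates. Its bijectivity serves
  twice: surjectivity yields the existence of normal parts, and the Gram matrix is the
  transpose of its matrix. Nondegeneracy gives injectivity, and equality of dimensions the rest.\<close>

lemma pullback_pairing_bij:
  fixes B :: "'v::real_vector \<Rightarrow> 'v \<Rightarrow> real" and D :: "real ^ 'm \<Rightarrow> 'v"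
  assumes B: "bilinear B" and D: "linear D"
    and nondeg: "nondegenerate (\<lambda>v w. B (D v) (D w))"
  shows "linear (\<lambda>u. (\<chi> j. B (D u) (D (axis j 1))) :: real ^ 'm)"
    and "bij (\<lambda>u. (\<chi> j. B (D u) (D (axis j 1))) :: real ^ 'm)"
proof -
  let ?L = "\<lambda>u. (\<chi> j. B (D u) (D (axis j 1))) :: real ^ 'm"
  show lin: "linear ?L"
    by (rule linearI) (simp_all add: vec_eq_iff linear_add[OF D] linear_scale[OF D]
        bilinear_ladd[OF B] bilinear_lmul[OF B])
  have "inj ?L"
  proof (subst linear_injective_0[OF lin], intro allI impI)
    fix u assume "?L u = 0"
    then have "B (D u) (D w) = B 0 (D w)" for w
      by - (rule bilinear_eq_on_range_from_axes[OF B D], simp add: vec_eq_iff bilinear_lzero[OF B])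
    then show "u = 0"
      using nondeg by (auto simp: nondegenerate_def bilinear_lzero[OF B])
  qed
  then show "bij ?L"
    by (simp add: bij_def linear_injective_imp_surjective[OF lin])
qed

text \<open>The functional \<open>B v\<close>, restricted to the image of \<open>D\<close>, is represented by a vector in that
  image, and subtracting this vector from \<open>v\<close> leaves the normal part.\<close>

lemma normal_part_range_unique:
  fixes B :: "'v::real_vector \<Rightarrow> 'v \<Rightarrow> real" and D :: "real ^ 'm \<Rightarrow> 'v"
  assumes B: "bilinear B" and D: "linear D"
    and nondeg: "nondegenerate (\<lambda>v w. B (D v) (D w))"
  shows "\<exists>!w. (\<forall>u\<in>range D. B w u = 0) \<and> v - w \<in> range D"
proof -
  note pairing = pullback_pairing_bij[OF B D nondeg]
  obtain u where u: "(\<chi> j. B v (D (axis j 1))) = (\<chi> j. B (D u) (D (axis j 1)))"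
    using surjD[OF bij_is_surj[OF pairing(2)]] by blast
  have u': "B (D u) (D w) = B v (D w)" for w
    using u by - (rule bilinear_eq_on_range_from_axes[OF B D], simp add: vec_eq_iff)
  show ?thesis
  proof (rule ex1I[of _ "v - D u"])
    show "(\<forall>x\<in>range D. B (v - D u) x = 0) \<and> v - (v - D u) \<in> range D"
      by (auto simp: bilinear_lsub[OF B] u')
  next
    fix w assume w: "(\<forall>x\<in>range D. B w x = 0) \<and> v - w \<in> range D"
    then obtain z where z: "v - w = D z" by auto
    have "B (D (z - u)) (D x) = 0" for x
      using w by (simp add: linear_diff[OF D] z[symmetric] bilinear_lsub[OF B] u')
    then have "z - u = 0"
      using nondeg unfolding nondegenerate_def by blast
    then show "w = v - D u"
      using z by (auto simp: algebra_simps)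
  qed
qed

text \<open>A normal vector does not see the tangential part of its partner.\<close>

lemma orthogonal_normal_part:
  fixes B :: "'v::real_vector \<Rightarrow> 'v \<Rightarrow> real" and D :: "real ^ 'm \<Rightarrow> 'v"
  assumes B: "bilinear B" and D: "linear D"
    and nondeg: "nondegenerate (\<lambda>v w. B (D v) (D w))"
    and normal: "\<And>u. B z (D u) = 0"
  shows "B z (normal_part B (range D) v) = B z v"
proof -
  let ?w = "normal_part B (range D) v"
  have "(\<forall>u\<in>range D. B ?w u = 0) \<and> v - ?w \<in> range D"
    unfolding normal_part_def by (rule theI'[OF normal_part_range_unique[OF B D nondeg]])
  then obtain u where "v - ?w = D u" by auto
  then have "B z (v - ?w) = 0" by (simp add: normal)
  then show ?thesis by (simp add: bilinear_rsub[OF B])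
qed

lemma normal_part_of_normal:
  fixes B :: "'v::real_vector \<Rightarrow> 'v \<Rightarrow> real" and D :: "real ^ 'm \<Rightarrow> 'v"
  assumes B: "bilinear B" and D: "linear D"
    and nondeg: "nondegenerate (\<lambda>v w. B (D v) (D w))"
    and normal: "\<And>u. B z (D u) = 0"
  shows "normal_part B (range D) z = z"
  unfolding normal_part_def
proof (rule the1_equality[OF normal_part_range_unique[OF B D nondeg]])
  have "0 \<in> range D"
    using linear_0[OF D] by (metis rangeI)
  then show "(\<forall>u\<in>range D. B z u = 0) \<and> z - z \<in> range D"
    using normal by auto
qed

lemma gram_invertible:
  fixes B :: "real ^ 'n \<Rightarrow> real ^ 'n \<Rightarrow> real" and f :: "real ^ 'm \<Rightarrow> real ^ 'n"
  assumes B: "bilinear B" and D: "linear (frechet_derivative f (at x))"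
    and nondeg: "nondegenerate (pullback_form B f x)"
  shows "invertible (gram B f x)"
proof -
  let ?D = "frechet_derivative f (at x)"
  let ?L = "\<lambda>u. (\<chi> j. B (?D u) (?D (axis j 1))) :: real ^ 'm"
  have nondeg': "nondegenerate (\<lambda>v w. B (?D v) (?D w))"
    using nondeg by (simp add: pullback_form_def[abs_def])
  note pairing = pullback_pairing_bij[OF B D nondeg']
  have "invertible (matrix ?L)"
    using pairing(2) by (simp add: invertible_eq_bij matrix_vector_mul(2)[OF pairing(1)])
  moreover have "gram B f x = transpose (matrix ?L)"
    by (simp add: gram_def pullback_form_def matrix_def transpose_def)
  ultimately show ?thesis
    by (simp add: invertible_det_nz det_transpose)
qed

lemma matrix_inv_mult_left:
  fixes M :: "real ^ 'm ^ 'm"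
  assumes "invertible M"
  shows "matrix_inv M ** M = mat 1"
  using someI_ex[OF assms[unfolded invertible_def]] by (simp add: matrix_inv_def)

section \<open>Immersions into the light cone\<close>

text \<open>Differentiating \<open>B (f y) (f y) = 0\<close> twice shows that pairing the position vector with the second
  fundamental tensor gives minus the induced metric. The trace of a metric with
  respect to itself is the dimension.\<close>

lemma null_position_mean_curvature:
  fixes B :: "real ^ 'n \<Rightarrow> real ^ 'n \<Rightarrow> real" and f :: "real ^ 'm \<Rightarrow> real ^ 'n"
  assumes B: "bilinear B" and sym: "\<And>x y. B x y = B y x"
    and V: "open V" "x \<in> V"
    and diff: "\<And>y. y \<in> V \<Longrightarrow> f differentiable (at y)"
    and diff2: "\<And>w. (\<lambda>y. frechet_derivative f (at y) w) differentiable (at x)"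
    and null: "\<And>y. y \<in> V \<Longrightarrow> B (f y) (f y) = 0"
    and nondeg: "nondegenerate (pullback_form B f x)"
  shows "\<And>v. B (f x) (frechet_derivative f (at x) v) = 0"
    and "B (f x) (mean_curvature B f x) = - real CARD('m)"
proof -
  let ?D = "\<lambda>y. frechet_derivative f (at y)"
  let ?D2 = "\<lambda>v w. frechet_derivative (\<lambda>y. ?D y w) (at x) v"
  have bb: "bounded_bilinear B"
    using B by (simp add: bilinear_conv_bounded_bilinear)
  have Df: "(f has_derivative ?D y) (at y)" if "y \<in> V" for y
    using diff[OF that] frechet_derivative_works by blast
  have zero: "(\<lambda>v. 0) = h'" if "(h has_derivative h') (at y)" "y \<in> V" "\<And>y. y \<in> V \<Longrightarrow> h y = 0"
    for h :: "real ^ 'm \<Rightarrow> real" and h' y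
  proof (rule has_derivative_unique)
    show "(h has_derivative (\<lambda>v. 0)) (at y)"
      by (rule has_derivative_transform_within_open[OF has_derivative_const V(1) that(2)])
        (simp add: that(3))
  qed (rule that(1))
  have normal: "B (f y) (?D y v) = 0" if "y \<in> V" for y v
    using fun_cong[OF zero[OF bounded_bilinear.FDERIV[OF bb Df[OF that] Df[OF that]] that null], of v]
    by (simp add: sym[of "?D y v" "f y"])
  then show normal_x: "\<And>v. B (f x) (?D x v) = 0"
    using V by blast
  have hess: "B (f x) (?D2 v w) = - pullback_form B f x w v" for v w
  proof -
    have "((\<lambda>y. ?D y w) has_derivative (\<lambda>v. ?D2 v w)) (at x)"
      using diff2 frechet_derivative_works by blast
    from fun_cong[OF zero[OF bounded_bilinear.FDERIV[OF bb Df[OF V(2)] this] V(2) normal], of v]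
    show ?thesis by (simp add: pullback_form_def sym[of "?D x w" "?D x v"])
  qed
  have lin: "linear (?D x)"
    using Df[OF V(2)] has_derivative_linear by blast
  have nondeg': "nondegenerate (\<lambda>v w. B (?D x v) (?D x w))"
    using nondeg by (simp add: pullback_form_def[abs_def])
  have "B (f x) (second_fundamental B f x v w) = - pullback_form B f x w v" for v w
    unfolding second_fundamental_def orthogonal_normal_part[OF B lin nondeg' normal_x] by (rule hess)
  moreover have "linear (B (f x))"
    using B by (simp add: bilinear_def)
  ultimately have "B (f x) (mean_curvature B f x) =
      - (\<Sum>i\<in>UNIV. \<Sum>j\<in>UNIV. matrix_inv (gram B f x) $ i $ j * gram B f x $ j $ i)"
    by (simp add: mean_curvature_def linear_sum linear_scale gram_def sum_negf)
  also have "\<dots> = - trace (matrix_inv (gram B f x) ** gram B f x)"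
    by (simp add: trace_def matrix_matrix_mult_def)
  also have "\<dots> = - real CARD('m)"
    by (simp add: matrix_inv_mult_left[OF gram_invertible[OF B lin nondeg]] trace_I)
  finally show "B (f x) (mean_curvature B f x) = - real CARD('m)" .
qed

section \<open>Nonexistence of homotheties that start in the light cone\<close>

text \<open>Smoothness on \<open>U \<times> I\<close> means that the map extends locally, so the derivatives of a time
  slice are read off from an extension, whose slice agrees with the given one on an open set.\<close>

lemma smooth_on_time_slice:
  fixes h :: "'a::euclidean_space \<Rightarrow> real \<Rightarrow> 'b::real_normed_vector"
  assumes smooth: "smooth_on (U \<times> I) (\<lambda>(x, t). h x t)"
    and U: "open U" "x \<in> U" and t: "t \<in> I"
  obtains V where "open V" "x \<in> V" "V \<subseteq> U"
    and "\<And>y. y \<in> V \<Longrightarrow> (\<lambda>x. h x t) differentiable (at y)"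
    and "\<And>w. (\<lambda>y. frechet_derivative (\<lambda>x. h x t) (at y) w) differentiable (at x)"
proof -
  have "\<exists>W g. open W \<and> (x, t) \<in> W \<and> (\<forall>k. Ck_on k W g) \<and>
      (\<forall>y\<in>(U \<times> I) \<inter> W. g y = (\<lambda>(x, t). h x t) y)"
    by (rule bspec[OF smooth[unfolded smooth_on_def]]) (simp add: U(2) t)
  then obtain W g where W: "open W" "(x, t) \<in> W" and Ck: "\<forall>k. Ck_on k W g"
    and ext: "\<forall>y\<in>(U \<times> I) \<inter> W. g y = (\<lambda>(x, t). h x t) y"
    by (elim exE conjE)
  define V where "V = U \<inter> (\<lambda>y. (y, t)) -` W"
  have V: "open V" "x \<in> V" "V \<subseteq> U"
    unfolding V_def using U W
    by (auto intro!: open_Int continuous_open_vimage continuous_intros)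
  have g1: "g differentiable (at z)"
    and g2: "(\<lambda>z. frechet_derivative g (at z) v) differentiable (at z)" if "z \<in> W" for z v
    using Ck[rule_format, of "Suc (Suc 0)"] that by (simp_all del: split_paired_All)
  have slice: "((\<lambda>y. k (y, t)) has_derivative (\<lambda>w. frechet_derivative k (at (y, t)) (w, 0))) (at y)"
    if "k differentiable (at (y, t))" for k :: "'a \<times> real \<Rightarrow> 'b" and y
  proof -
    have "((\<lambda>y. (y, t)) has_derivative (\<lambda>w. (w, 0))) (at y)"
      by (auto intro!: derivative_eq_intros)
    from has_derivative_compose[OF this that[unfolded frechet_derivative_works]] show ?thesis .
  qed
  have deriv: "((\<lambda>x. h x t) has_derivative (\<lambda>w. frechet_derivative g (at (y, t)) (w, 0))) (at y)"
    if "y \<in> V" for y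
    by (rule has_derivative_transform_within_open[OF slice V(1) that])
      (use that t g1 ext in \<open>auto simp: V_def\<close>)
  show ?thesis
  proof (rule that[OF V])
    show "(\<lambda>x. h x t) differentiable (at y)" if "y \<in> V" for y
      by (rule differentiableI[OF deriv[OF that]])
    show "(\<lambda>y. frechet_derivative (\<lambda>x. h x t) (at y) w) differentiable (at x)" for w
    proof -
      have "frechet_derivative g (at (y, t)) (w, 0) = frechet_derivative (\<lambda>x. h x t) (at y) w"
        if "y \<in> V" for y
        using fun_cong[OF frechet_derivative_at[OF deriv[OF that]]] .
      from differentiableI[OF has_derivative_transform_within_open[OF slice[OF g2[OF W(2)]] V(1,2) this]]
      show ?thesis .
    qed
  qed
qed

theorem theorem3p9:
  fixes B :: "real ^ 'n \<Rightarrow> real ^ 'n \<Rightarrow> real"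
    and X :: "'a topology"
    and A :: "('a, 'm::finite) chart set"
    and T :: ereal
  assumes "bilinear B" and "\<And>x y. B x y = B y x" and "nondegenerate B"
    and "smooth_manifold X A" and "topspace X \<noteq> {}"
    and "connected_space X" and "orientable X A"
    and "T > 0"
  shows "\<not> (\<exists>F. mcf_homothety B X A T F \<and>
               complete_metric B X A (\<lambda>p. F p 0) \<and>
               (\<lambda>p. F p 0) ` topspace X \<subseteq> light_cone B)"
proof
  assume "\<exists>F. mcf_homothety B X A T F \<and> complete_metric B X A (\<lambda>p. F p 0) \<and>
               (\<lambda>p. F p 0) ` topspace X \<subseteq> light_cone B"
  then obtain F where hom: "mcf_homothety B X A T F"
    and cone: "(\<lambda>p. F p 0) ` topspace X \<subseteq> light_cone B" by blast
  obtain p where p: "p \<in> topspace X" using assms(5) by blast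
  have t0: "0 \<in> time_interval T"
    using \<open>T > 0\<close> by (simp add: time_interval_def zero_ereal_def)
  have charts: "\<forall>c\<in>A. is_chart X c" and cover: "(\<Union>c\<in>A. fst c) = topspace X"
    using assms(4) by (auto simp: smooth_manifold_def smooth_atlas_def)
  define c where "c = chart_at A p"
  have "\<exists>c. c \<in> A \<and> p \<in> fst c"
    using p cover by blast
  from someI_ex[OF this] have c: "c \<in> A" "p \<in> fst c"
    by (simp_all add: c_def chart_at_def)
  have sub: "fst c \<subseteq> topspace X" and opn: "open (snd c ` fst c)"
    and homeo: "homeomorphic_map (subtopology X (fst c)) (top_of_set (snd c ` fst c)) (snd c)"
    using charts c(1) by (simp_all add: is_chart_def openin_subset)
  have inj: "inj_on (snd c) (fst c)"
    using homeomorphic_imp_injective_map[OF homeo] sub by (simp add: Int_absorb1)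
  define f where "f = local_rep c (\<lambda>q. F q 0)"
  define x where "x = snd c p"
  have fx: "f x = F p 0"
    using inj c(2) by (simp add: f_def x_def local_rep_def inv_into_f_f)
  have rep: "rep_at A (\<lambda>q. F q 0) p = f" "coord_at A p = x"
    by (simp_all add: rep_at_def coord_at_def f_def x_def c_def)
  have sol: "mcf_solution B X A T F"
    using hom by (simp add: mcf_homothety_def)
  have smooth: "smooth_on ((snd c ` fst c) \<times> time_interval T) (\<lambda>(x, t). local_rep c F x t)"
    using sol c(1) by (simp add: mcf_solution_def)
  have "nondegenerate (induced_metric B A (\<lambda>q. F q 0) p)"
    using sol p t0 by (simp add: mcf_solution_def)
  then have nondeg: "nondegenerate (pullback_form B f x)"
    by (simp add: induced_metric_def rep)
  have slice: "(\<lambda>x. local_rep c F x 0) = f"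
    by (simp add: f_def local_rep_def fun_eq_iff)
  obtain V where V: "open V" "x \<in> V" "V \<subseteq> snd c ` fst c"
    and diff: "\<And>y. y \<in> V \<Longrightarrow> f differentiable (at y)"
    and diff2: "\<And>w. (\<lambda>y. frechet_derivative f (at y) w) differentiable (at x)"
    using smooth_on_time_slice[OF smooth opn _ t0, of x] c(2) unfolding slice x_def by blast
  have null: "B (f y) (f y) = 0" if "y \<in> V" for y
  proof -
    have "inv_into (fst c) (snd c) y \<in> topspace X"
      using that V(3) sub inv_into_into[of y "snd c" "fst c"] by blast
    then show ?thesis
      using cone by (auto simp: light_cone_def f_def local_rep_def)
  qed
  note position = null_position_mean_curvature[OF assms(1,2) V(1,2) diff diff2 null nondeg]
  have lin: "linear (frechet_derivative f (at x))"
    using linear_frechet_derivative[OF diff[OF V(2)]] .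
  have nondeg': "nondegenerate
      (\<lambda>v w. B (frechet_derivative f (at x) v) (frechet_derivative f (at x) w))"
    using nondeg by (simp add: pullback_form_def[abs_def])
  have "normal_component B A (\<lambda>q. F q 0) p (F p 0) = f x"
    using normal_part_of_normal[OF assms(1) lin nondeg' position(1)]
    by (simp add: normal_component_def differential_def rep fx)
  moreover obtain a where "mean_curvature_vector B A (\<lambda>q. F q 0) p =
      a *\<^sub>R normal_component B A (\<lambda>q. F q 0) p (F p 0)"
    using hom p t0 unfolding mcf_homothety_def by blast
  ultimately have "mean_curvature B f x = a *\<^sub>R f x"
    by (simp add: mean_curvature_vector_def rep)
  then have "B (f x) (mean_curvature B f x) = 0"
    using null[OF V(2)] by (simp add: bilinear_rmul[OF assms(1)])
  then show False
    using position(2) by simp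
qed

end
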